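(* For each $(p,q)\in\mathbb{Z}^2$ with $\min\{p,q\}\geq 1$, define the polynomial function $\varphi^{(p,q)}$ on the open unit disk $\mathbb{D}=\{z\in\mathbb{C}: |z|<1\}$ by $$\varphi^{(p,q)}(z)=\frac{(-1)^p}{q\,(p+q-1)!}\,(1-z\bar z)\,\frac{\partial^{p+q}}{\partial z^p\,\partial\bar z^q}(1-z\bar z)^{p+q-1}.$$ Then the family $\left\{\varphi^{(p,q)} : (p,q)\in\mathbb{Z}^2,\ \min\{p,q\}\geq 1\right\}$ is an orthogonal basis for the Hilbert space $L^2\bigl(\mathbb{D},\tfrac{dx\,dy}{1-x^2-y^2}\bigr)$.
   Context: Points of the unit disk are written $z=x+iy$ with $x,y\in\mathbb{R}$, and $\frac{\partial}{\partial z}=\frac12\left(\frac{\partial}{\partial x}-i\frac{\partial}{\partial y}\right)$, $\frac{\partial}{\partial\bar z}=\frac12\left(\frac{\partial}{\partial x}+i\frac{\partial}{\partial y}\right)$ are the Wirtinger derivatives (i.e. $z$ and $\bar z$ are treated as independent variables when differentiating polynomials in $z,\bar z$). The polynomials $\varphi^{(p,q)}$ are called scattering polynomials. The space $L^2\bigl(\mathbb{D},\frac{dx\,dy}{1-x^2-y^2}\bigr)$ consists of (classes of) complex-valued measurable functions on $\mathbb{D}$ that are square integrable with respect to the measure $\frac{dx\,dy}{1-x^2-y^2}$, with scalar product $\langle f,g\rangle=\int_{\mathbb{D}} f(x,y)\,\overline{g(x,y)}\,\frac{dx\,dy}{1-x^2-y^2}$. An orthogonal basis of a Hilbert space is a family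 of nonzero, pairwise orthogonal elements whose linear span is dense (the elements are not required to have norm one). *)

theory Defs
  imports "HOL-Analysis.Analysis"
begin

definition partial_x :: "(complex \<Rightarrow> complex) \<Rightarrow> complex \<Rightarrow> complex" where
  "partial_x f z = vector_derivative (\<lambda>x. f (Complex x (Im z))) (at (Re z))"

definition partial_y :: "(complex \<Rightarrow> complex) \<Rightarrow> complex \<Rightarrow> complex" where
  "partial_y f z = vector_derivative (\<lambda>y. f (Complex (Re z) y)) (at (Im z))"

definition wirtinger :: "(complex \<Rightarrow> complex) \<Rightarrow> complex \<Rightarrow> complex" where
  "wirtinger f z = (1/2) * (partial_x f z - \<i> * partial_y f z)"

definition wirtinger_bar :: "(complex \<Rightarrow> complex) \<Rightarrow> complex \<Rightarrow> complex" where
  "wirtinger_bar f z = (1/2) * (partial_x f z + \<i> * partial_y f z)"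

(* Meaningful for p, q >= 1 only, where the natural number subtraction does not truncate. *)
definition scattering_poly :: "nat \<Rightarrow> nat \<Rightarrow> complex \<Rightarrow> complex" where
  "scattering_poly p q z =
     (-1) ^ p / (of_nat q * fact (p + q - 1)) * (1 - z * cnj z) *
     (wirtinger ^^ p) ((wirtinger_bar ^^ q) (\<lambda>w. (1 - w * cnj w) ^ (p + q - 1))) z"

definition disk_measure :: "complex measure" where
  "disk_measure =
     density (lebesgue_on (ball 0 1)) (\<lambda>z. ennreal (1 / (1 - (Re z)\<^sup>2 - (Im z)\<^sup>2)))"

(* L2 spaces are represented by functions instead of classes modulo almost everywhere
   equality: a function represents the zero vector iff it vanishes almost everywhere, and
   distances are measured by the seminorm l2_norm, which is the norm of the class. *)
definition L2 :: "'a measure \<Rightarrow> ('a \<Rightarrow> complex) set" where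
  "L2 M = {f \<in> borel_measurable M. integrable M (\<lambda>x. (norm (f x))\<^sup>2)}"

definition l2_inner :: "'a measure \<Rightarrow> ('a \<Rightarrow> complex) \<Rightarrow> ('a \<Rightarrow> complex) \<Rightarrow> complex" where
  "l2_inner M f g = (LINT x|M. f x * cnj (g x))"

definition l2_norm :: "'a measure \<Rightarrow> ('a \<Rightarrow> complex) \<Rightarrow> real" where
  "l2_norm M f = sqrt (Re (l2_inner M f f))"

definition complex_span :: "'i set \<Rightarrow> ('i \<Rightarrow> 'a \<Rightarrow> complex) \<Rightarrow> ('a \<Rightarrow> complex) set" where
  "complex_span I e = {(\<lambda>x. \<Sum>i\<in>F. c i * e i x) | F c. finite F \<and> F \<subseteq> I}"

definition orthogonal_basis_L2 :: "'a measure \<Rightarrow> 'i set \<Rightarrow> ('i \<Rightarrow> 'a \<Rightarrow> complex) \<Rightarrow> bool" where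
  "orthogonal_basis_L2 M I e \<longleftrightarrow>
     (\<forall>i\<in>I. e i \<in> L2 M \<and> \<not> (AE x in M. e i x = 0)) \<and>
     (\<forall>i\<in>I. \<forall>j\<in>I. i \<noteq> j \<longrightarrow> l2_inner M (e i) (e j) = 0) \<and>
     (\<forall>f\<in>L2 M. \<forall>\<epsilon>>0. \<exists>g\<in>complex_span I e. l2_norm M (\<lambda>x. f x - g x) < \<epsilon>)"

end

(* The factor 1 - |z|^2 in phi^(p,q) turns the measure into (1 - |z|^2) dx dy.  Expanding the
   Wirtinger derivatives gives phi^(p,q) = c (1 - |z|^2) sum_k a_k z^(k-p) cnj(z)^(k-q).
   Rotation invariance makes polynomials of different angular degree orthogonal; within one
   angular degree, pairing phi^(p,q) with a monomial of lower degree gives the sum of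
   (-1)^k (m choose k) R(k) over k <= m with m = p + q - 1 and deg R < m, an m-th finite
   difference that vanishes.  The top coefficients are nonzero, so the phi^(p,q) span all
   functions (1 - |z|^2) P(z, cnj z); these are dense because polynomials are dense in
   L^2((1 - |z|^2) dx dy), by truncation, continuous approximation and Stone-Weierstrass. *)

theory Submission
  imports Defs
begin

subsection \<open>Wirtinger derivatives and the coefficient identity\<close>

text \<open>The obstacle is the denominator (n + 1) (n + 2) in the integral of (1 - |z|^2) |z|^(2
  n): in a pairing, n grows with k, so the summand looks rational in k rather than polynomial.
  Differentiating p + q times supplies p + q linear factors in k, and two of them cancel the
  denominator. What remains has degree p + q - 2, just below the order p + q - 1 of the finite
  difference. The two factors are present only if the monomial has low enough degree. This suffices
  because two distinct index pairs of the same angular degree differ by a multiple of (1,1), so one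
  of them is smaller in both coordinates. Exponents such as k - p use truncated subtraction
  throughout; wherever it would truncate, the coefficient is 0. The leading monomial of the cofactor
  of 1 - |z|^2 in phi^(p,q) is z^(q-1) cnj(z)^(p-1), so (p,q) -> (q - 1, p - 1) matches the family
  with all monomials and the system is triangular.\<close>

lemma has_vector_derivative_power_cnj_Re:
  "((\<lambda>x. Complex x y ^ a * cnj (Complex x y) ^ b) has_vector_derivative
     of_nat a * Complex x y ^ (a - 1) * cnj (Complex x y) ^ b +
     of_nat b * Complex x y ^ a * cnj (Complex x y) ^ (b - 1)) (at x)"
  unfolding Complex_eq complex_cnj_add complex_cnj_mult complex_cnj_complex_of_real complex_cnj_i
    has_vector_derivative_def
  by (rule derivative_eq_intros refl)+ (simp add: fun_eq_iff scaleR_conv_of_real algebra_simps)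

lemma has_vector_derivative_power_cnj_Im:
  "((\<lambda>y. Complex x y ^ a * cnj (Complex x y) ^ b) has_vector_derivative
     \<i> * (of_nat a * Complex x y ^ (a - 1) * cnj (Complex x y) ^ b -
          of_nat b * Complex x y ^ a * cnj (Complex x y) ^ (b - 1))) (at y)"
  unfolding Complex_eq complex_cnj_add complex_cnj_mult complex_cnj_complex_of_real complex_cnj_i
    has_vector_derivative_def
  by (rule derivative_eq_intros refl)+ (simp add: fun_eq_iff scaleR_conv_of_real algebra_simps)

lemma partial_x_sum_monomials:
  "partial_x (\<lambda>z. \<Sum>k\<in>K. c k * (z ^ a k * cnj z ^ b k)) z =
    (\<Sum>k\<in>K. c k * (of_nat (a k) * z ^ (a k - 1) * cnj z ^ b k +
                    of_nat (b k) * z ^ a k * cnj z ^ (b k - 1)))"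
proof -
  have "((\<lambda>x. \<Sum>k\<in>K. c k * (Complex x (Im z) ^ a k * cnj (Complex x (Im z)) ^ b k))
      has_vector_derivative
        (\<Sum>k\<in>K. c k * (of_nat (a k) * z ^ (a k - 1) * cnj z ^ b k +
                    of_nat (b k) * z ^ a k * cnj z ^ (b k - 1)))) (at (Re z))"
    using has_vector_derivative_power_cnj_Re[of "Im z" _ _ "Re z"]
    by (intro has_vector_derivative_sum has_vector_derivative_mult_right) simp
  then show ?thesis
    unfolding partial_x_def by (rule vector_derivative_at)
qed

lemma partial_y_sum_monomials:
  "partial_y (\<lambda>z. \<Sum>k\<in>K. c k * (z ^ a k * cnj z ^ b k)) z =
    (\<Sum>k\<in>K. c k * (\<i> * (of_nat (a k) * z ^ (a k - 1) * cnj z ^ b k -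
                    of_nat (b k) * z ^ a k * cnj z ^ (b k - 1))))"
proof -
  have "((\<lambda>y. \<Sum>k\<in>K. c k * (Complex (Re z) y ^ a k * cnj (Complex (Re z) y) ^ b k))
      has_vector_derivative
        (\<Sum>k\<in>K. c k * (\<i> * (of_nat (a k) * z ^ (a k - 1) * cnj z ^ b k -
                    of_nat (b k) * z ^ a k * cnj z ^ (b k - 1))))) (at (Im z))"
    using has_vector_derivative_power_cnj_Im[of "Re z" _ _ "Im z"]
    by (intro has_vector_derivative_sum has_vector_derivative_mult_right) simp
  then show ?thesis
    unfolding partial_y_def by (rule vector_derivative_at)
qed

text \<open>On monomials d/dx acts as d/dz + d/dcnj(z) and d/dy as i (d/dz - d/dcnj(z)), so one of
  the two parts cancels. The result has the shape of the input, with new coefficients and exponents,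
  which allows iteration.\<close>

lemma wirtinger_sum_monomials:
  "wirtinger (\<lambda>z. \<Sum>k\<in>K. c k * (z ^ a k * cnj z ^ b k)) =
    (\<lambda>z. \<Sum>k\<in>K. c k * of_nat (a k) * (z ^ (a k - 1) * cnj z ^ b k))"
  unfolding wirtinger_def partial_x_sum_monomials partial_y_sum_monomials
    sum_distrib_left sum_subtractf[symmetric]
  by (intro ext sum.cong refl) (simp add: algebra_simps)

lemma wirtinger_bar_sum_monomials:
  "wirtinger_bar (\<lambda>z. \<Sum>k\<in>K. c k * (z ^ a k * cnj z ^ b k)) =
    (\<lambda>z. \<Sum>k\<in>K. c k * of_nat (b k) * (z ^ a k * cnj z ^ (b k - 1)))"
  unfolding wirtinger_bar_def partial_x_sum_monomials partial_y_sum_monomials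
    sum_distrib_left sum.distrib[symmetric]
  by (intro ext sum.cong refl) (simp add: algebra_simps)

text \<open>The falling factorial x (x - 1) ... (x - p + 1). It lives in a ring, so its factors do
  not truncate and it is a polynomial in x.\<close>

definition falling_fact :: "nat \<Rightarrow> 'a::comm_ring_1 \<Rightarrow> 'a" where
  "falling_fact p x = (\<Prod>i<p. x - of_nat i)"

lemma falling_fact_of_nat_eq_0: "k < p \<Longrightarrow> falling_fact p (of_nat k) = 0"
  unfolding falling_fact_def by (rule prod_zero) auto

lemma falling_fact_of_nat_neq_0:
  "p \<le> k \<Longrightarrow> falling_fact p (of_nat k :: 'a::{idom, ring_char_0}) \<noteq> 0"
  by (auto simp: falling_fact_def)

text \<open>The factor to be added is k - p in the ring. It agrees with the truncated difference for
  p <= k; for k < p both sides are 0.\<close>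

lemma falling_fact_Suc_of_nat:
  "falling_fact p (of_nat k) * of_nat (k - p) = falling_fact (Suc p) (of_nat k)"
proof (cases "k < p")
  case False
  then show ?thesis by (simp add: falling_fact_def of_nat_diff)
qed (simp add: falling_fact_of_nat_eq_0)

text \<open>The truncated exponents k - p are harmless: the falling factorial vanishes when k < p.\<close>

lemma wirtinger_funpow_sum_monomials:
  "(wirtinger ^^ p) (\<lambda>z. \<Sum>k\<in>K. c k * (z ^ k * cnj z ^ b k)) =
    (\<lambda>z. \<Sum>k\<in>K. c k * falling_fact p (of_nat k) * (z ^ (k - p) * cnj z ^ b k))"
proof (induction p)
  case (Suc p)
  show ?case
    unfolding funpow.simps comp_def Suc.IH wirtinger_sum_monomials
    by (simp add: mult.assoc[of "c _"] falling_fact_Suc_of_nat)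
qed (simp add: falling_fact_def)

lemma wirtinger_bar_funpow_sum_monomials:
  "(wirtinger_bar ^^ q) (\<lambda>z. \<Sum>k\<in>K. c k * (z ^ a k * cnj z ^ k)) =
    (\<lambda>z. \<Sum>k\<in>K. c k * falling_fact q (of_nat k) * (z ^ a k * cnj z ^ (k - q)))"
proof (induction q)
  case (Suc q)
  show ?case
    unfolding funpow.simps comp_def Suc.IH wirtinger_bar_sum_monomials
    by (simp add: mult.assoc[of "c _"] falling_fact_Suc_of_nat)
qed (simp add: falling_fact_def)

text \<open>What both derivatives make of the k-th term of the binomial expansion of (1 - z
  cnj(z))^(p+q-1). It is real, and nonzero exactly for max p q <= k <= p + q - 1.\<close>

definition scattering_coeff :: "nat \<Rightarrow> nat \<Rightarrow> nat \<Rightarrow> complex" where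
  "scattering_coeff p q k = (- 1) ^ k * of_nat ((p + q - 1) choose k) *
     falling_fact p (of_nat k) * falling_fact q (of_nat k)"

lemma scattering_coeff_eq_0: "k < p \<or> k < q \<Longrightarrow> scattering_coeff p q k = 0"
  by (auto simp: scattering_coeff_def falling_fact_of_nat_eq_0)

text \<open>As p and q are positive, p + q - 1 is at least p and at least q, so neither falling
  factorial vanishes. Both the nonvanishing of phi^(p,q) and completeness rest on this.\<close>

lemma scattering_coeff_top_neq_0:
  "p \<ge> 1 \<Longrightarrow> q \<ge> 1 \<Longrightarrow> scattering_coeff p q (p + q - 1) \<noteq> 0"
  by (simp add: scattering_coeff_def falling_fact_of_nat_neq_0 del: of_nat_diff of_nat_add)

lemma cnj_scattering_coeff [simp]: "cnj (scattering_coeff p q k) = scattering_coeff p q k"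
  by (simp add: scattering_coeff_def falling_fact_def)

lemma scattering_poly_eq:
  "scattering_poly p q z =
     (-1) ^ p / (of_nat q * fact (p + q - 1)) * (1 - z * cnj z) *
     (\<Sum>k\<le>p + q - 1. scattering_coeff p q k * (z ^ (k - p) * cnj z ^ (k - q)))"
proof -
  let ?m = "p + q - 1"
  have "(1 - w * cnj w) ^ ?m =
      (\<Sum>k\<le>?m. ((- 1) ^ k * of_nat (?m choose k)) * (w ^ k * cnj w ^ k))" for w :: complex
  proof -
    have "(1 - w * cnj w) ^ ?m = (\<Sum>k\<le>?m. of_nat (?m choose k) * (- (w * cnj w)) ^ k)"
      using binomial_ring[of "- (w * cnj w)" 1 ?m] by simp
    then show ?thesis
      by (simp add: power_minus[of "w * cnj w"] power_mult_distrib mult_ac)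
  qed
  then show ?thesis
    unfolding scattering_poly_def scattering_coeff_def
    \<comment> \<open>The inner derivatives lower the exponent of cnj(z) to k - q and leave z^k
      alone, so the outer ones again meet exponent k in their own variable, next to an arbitrary
      exponent in the other.\<close>
    by (simp only: wirtinger_bar_funpow_sum_monomials wirtinger_funpow_sum_monomials)
      (simp add: mult_ac)
qed

section \<open>Finite differences of polynomials\<close>

lemma alternating_binomial_sum_Suc:
  fixes f :: "nat \<Rightarrow> 'a::comm_ring_1"
  shows "(\<Sum>k\<le>Suc m. (- 1) ^ k * of_nat (Suc m choose k) * f k) =
    (\<Sum>k\<le>m. (- 1) ^ k * of_nat (m choose k) * (f k - f (Suc k)))"
proof -
  \<comment> \<open>Pascal's rule after splitting off k = 0. The half with
    \<open>m choose Suc k\<close>, together with f 0, is row m paired with f; the other half is row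
    m paired with the shifted f.\<close>
  have "(\<Sum>k\<le>Suc m. (- 1) ^ k * of_nat (Suc m choose k) * f k) =
      f 0 + (\<Sum>k\<le>m. (- 1) ^ Suc k * of_nat (m choose Suc k) * f (Suc k)) +
      (\<Sum>k\<le>m. (- 1) ^ Suc k * of_nat (m choose k) * f (Suc k))"
    by (subst sum.atMost_Suc_shift) (simp add: sum.distrib[symmetric] algebra_simps)
  also have "f 0 + (\<Sum>k\<le>m. (- 1) ^ Suc k * of_nat (m choose Suc k) * f (Suc k)) =
      (\<Sum>k\<le>Suc m. (- 1) ^ k * of_nat (m choose k) * f k)"
    by (subst sum.atMost_Suc_shift) simp
  also have "\<dots> = (\<Sum>k\<le>m. (- 1) ^ k * of_nat (m choose k) * f k)"
    by (simp add: binomial_eq_0)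
  finally show ?thesis
    by (simp add: sum.distrib[symmetric] algebra_simps)
qed

text \<open>Passing from row m + 1 to row m replaces P(x) by P(x) - P(x + 1), where the leading
  terms cancel and the degree drops.\<close>

lemma alternating_binomial_sum_poly:
  fixes P :: "'a::idom poly"
  assumes "degree P < m"
  shows "(\<Sum>k\<le>m. (- 1) ^ k * of_nat (m choose k) * poly P (of_nat k)) = 0"
  using assms
proof (induction m arbitrary: P)
  case (Suc m)
  define D where "D = P - pcompose P [:1, 1:]"
  have "(\<Sum>k\<le>m. (- 1) ^ k * of_nat (m choose k) * poly D (of_nat k)) = 0"
  \<comment> \<open>A constant P gives D = 0, whose degree counts as 0 and so does not drop.\<close>
  proof (cases "D = 0")
    case False
    have "degree D \<le> degree P"
      unfolding D_def by (intro degree_diff_le) (auto simp: degree_pcompose)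
    moreover have "degree D \<noteq> degree P"
    proof
      assume eq: "degree D = degree P"
      have "coeff D (degree P) = 0"
        using lead_coeff_comp[of "[:1, 1:]" P] by (simp add: D_def degree_pcompose)
      with eq False show False by (metis leading_coeff_0_iff)
    qed
    ultimately show ?thesis using Suc by simp
  qed simp
  then show ?case
    by (simp add: alternating_binomial_sum_Suc D_def poly_pcompose del: sum.atMost_Suc)
qed simp

text \<open>The two linear factors in the denominator cancel against the factors of index p - e - 1 and
  p - e - 2 of the falling factorial, leaving a polynomial in k of degree p + q - 2.\<close>

lemma scattering_coeff_alternating_sum:
  assumes e: "e + 2 \<le> p" and cq: "c + 2 \<le> q" and ce: "p + c = q + e"
  shows "(\<Sum>k\<le>p + q - 1. scattering_coeff p q k * 
      (1 / (of_nat (k - p + e + 1) * of_nat (k - p + e + 2)))) = 0"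
proof -
  define I where "I = {..<p} - {p - e - 1, p - e - 2}"
  define P :: "complex poly" where 
    "P = (\<Prod>i\<in>I. [:- of_nat i, 1:]) * (\<Prod>i<q. [:- of_nat i, 1:])"
  have card: "card I = p - 2"
    using e by (subst I_def, subst card_Diff_subset) auto
  have "degree P = card I + q"
    unfolding P_def
    by (subst degree_mult_eq) (auto simp: degree_prod_eq_sum_degree I_def)
  then have "degree P < p + q - 1"
    using e card by simp
  then have "(\<Sum>k\<le>p + q - 1. (- 1) ^ k * of_nat ((p + q - 1) choose k) * poly P (of_nat k)) = 0"
    by (rule alternating_binomial_sum_poly)
  moreover have "scattering_coeff p q k * 
      (1 / (of_nat (k - p + e + 1) * of_nat (k - p + e + 2))) =
     (- 1) ^ k * of_nat ((p + q - 1) choose k) * poly P (of_nat k)" for k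
  proof -
    have Pk: "poly P (of_nat k) = (\<Prod>i\<in>I. of_nat k - of_nat i) * falling_fact q (of_nat k)"
      by (simp add: P_def poly_prod falling_fact_def)
    show ?thesis
    proof (cases "k < q \<or> k < p")
      case True
      have "poly P (of_nat k) = 0"
      proof (cases "k < q")
        case False
        \<comment> \<open>Here q <= k < p. The omitted indices are p - e - 1 = q - c - 1 and its
          predecessor, both below q, so the factor that vanishes at k is still in the
          product.\<close>
        with True e cq ce have "k \<in> I" by (auto simp: I_def)
        then show ?thesis unfolding Pk by (auto simp: I_def)
      qed (simp add: Pk falling_fact_of_nat_eq_0)
      with True show ?thesis by (auto simp: scattering_coeff_eq_0)
    next
      case False
      have ins: "{..<p} = insert (p - e - 1) (insert (p - e - 2) I)"
        using e by (auto simp: I_def)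
      have "falling_fact p (of_nat k :: complex) =
          (of_nat k - of_nat (p - e - 1)) * ((of_nat k - of_nat (p - e - 2)) *
          (\<Prod>i\<in>I. of_nat k - of_nat i))"
        unfolding falling_fact_def ins using e
        by (subst prod.insert, simp add: I_def, force simp add: I_def, subst prod.insert)
          (auto simp: I_def)
      also have "of_nat k - of_nat (p - e - 1) = (of_nat (k - p + e + 1) :: complex)"
      proof -
        have "k - (p - e - 1) = k - p + e + 1" "p - e - 1 \<le> k"
          using False e by auto
        then show ?thesis by (metis of_nat_diff)
      qed
      also have "of_nat k - of_nat (p - e - 2) = (of_nat (k - p + e + 2) :: complex)"
      proof -
        have "k - (p - e - 2) = k - p + e + 2" "p - e - 2 \<le> k"
          using False e by auto
        then show ?thesis by (metis of_nat_diff)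
      qed
      finally have ff: "falling_fact p (of_nat k :: complex) = 
         of_nat (k - p + e + 1) * (of_nat (k - p + e + 2) * (\<Prod>i\<in>I. of_nat k - of_nat i))" .
      have nz: "of_nat (k - p + e + 1) \<noteq> (0::complex)" "of_nat (k - p + e + 2) \<noteq> (0::complex)"
        unfolding of_nat_eq_0_iff by auto
      have cancel: "s * (u * (v * w)) * x * (1 / (u * v)) = s * (w * x)"
        if "u \<noteq> 0" "v \<noteq> 0" for s u v w x :: complex
        using that by (simp add: field_simps)
      show ?thesis
        unfolding scattering_coeff_def Pk ff by (rule cancel[OF nz])
    qed
  qed
  ultimately show ?thesis by simp
qed

subsection \<open>Integrals of monomials over the unit disk\<close>

lemma distr_lborel_vec2_complex:
  "lborel = distr (lborel :: (real^2) measure) borel (\<lambda>v. Complex (v $ 1) (v $ 2))"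
proof (rule lborel_eqI)
  have meas: "(\<lambda>v::real^2. Complex (v $ 1) (v $ 2)) \<in> borel_measurable borel"
    unfolding Complex_eq by (intro borel_measurable_continuous_onI continuous_intros)
  fix l u :: complex
  assume le: "\<And>b. b \<in> Basis \<Longrightarrow> l \<bullet> b \<le> u \<bullet> b"
  define l' u' :: "real^2" where "l' = vector [Re l, Im l]" and "u' = vector [Re u, Im u]"
  have Basis2: "Basis = {axis 1 1 :: real^2, axis 2 1}"
    by (auto simp: Basis_vec_def UNIV_2)
  have ax: "axis 1 1 \<noteq> (axis 2 1 :: real^2)"
    by (simp add: axis_eq_axis)
  have "(\<lambda>v::real^2. Complex (v $ 1) (v $ 2)) -` box l u = box l' u'"
    by (auto simp: box_def Basis_complex_def Basis2 l'_def u'_def inner_axis)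
  moreover have "emeasure lborel (box l' u') = (\<Prod>b\<in>Basis. (u' - l') \<bullet> b)"
    using le[of 1] le[of \<i>] by (intro emeasure_lborel_box)
      (auto simp: Basis2 Basis_complex_def l'_def u'_def inner_axis)
  moreover have "(\<Prod>b\<in>Basis. (u' - l') \<bullet> b) = (\<Prod>b\<in>Basis. (u - l) \<bullet> b)"
    using ax by (simp add: Basis2 Basis_complex_def l'_def u'_def inner_axis)
  ultimately show "emeasure (distr lborel borel (\<lambda>v::real^2. Complex (v $ 1) (v $ 2))) (box l u) =
      ennreal (\<Prod>b\<in>Basis. (u - l) \<bullet> b)"
    using meas by (simp add: emeasure_distr)
qed simp

text \<open>Boxes determine \<open>lborel\<close>. The preimage of a box under the rotation is
  carried to real^2, where an orthogonal transformation preserves measure.\<close>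

lemma lborel_distr_rotation:
  fixes w :: complex
  assumes w: "norm w = 1"
  shows "distr lborel borel ((*) w) = lborel"
proof (rule lborel_eqI[symmetric])
  define \<Phi> :: "real^2 \<Rightarrow> complex" where "\<Phi> = (\<lambda>v. Complex (v $ 1) (v $ 2))"
  have cont: "continuous_on UNIV \<Phi>"
    unfolding \<Phi>_def Complex_eq by (intro continuous_intros)
  have distr: "lborel = distr lborel borel \<Phi>"
    unfolding \<Phi>_def by (rule distr_lborel_vec2_complex)
  \<comment> \<open>Multiplication by \<open>cnj w\<close>, the inverse of w: the preimage under the
    rotation then becomes an image under T.\<close>
  define T :: "real^2 \<Rightarrow> real^2" where "T v = vector [Re (cnj w * \<Phi> v), Im (cnj w * \<Phi> v)]" for v
  have \<Phi>T: "\<Phi> (T v) = cnj w * \<Phi> v" for v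
    by (simp add: \<Phi>_def T_def complex_eq_iff)
  have w2: "w * cnj w = 1"
    using w by (simp add: complex_norm_square[symmetric])
  have "linear T"
    by (rule linearI) (simp_all add: T_def \<Phi>_def vec_eq_iff forall_2 algebra_simps)
  moreover have "norm (T v) = norm v" for v
  proof -
    have nrm: "norm v = norm (\<Phi> v)" for v :: "real^2"
      by (simp add: norm_vec_def L2_set_def sum_2 \<Phi>_def cmod_def)
    show ?thesis unfolding nrm \<Phi>T using w by (simp add: norm_mult)
  qed
  ultimately have T: "orthogonal_transformation T"
    by (simp add: orthogonal_transformation)
  fix l u :: complex
  assume le: "\<And>b. b \<in> Basis \<Longrightarrow> l \<bullet> b \<le> u \<bullet> b"
  define S where "S = \<Phi> -` box l u"
  have open_S: "open S"
    unfolding S_def using open_vimage[OF open_box cont] .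
  have eS: "emeasure lborel S = emeasure lborel (box l u)"
  proof -
    have "emeasure lborel (box l u) = emeasure (distr lborel borel \<Phi>) (box l u)"
      using distr by simp
    also have "\<dots> = emeasure lborel S"
      using cont by (subst emeasure_distr) (auto simp: S_def intro: borel_measurable_continuous_onI)
    finally show ?thesis ..
  qed
  have S: "S \<in> lmeasurable"
    using open_S eS emeasure_lborel_box_finite[of l u]
    by (intro fmeasurableI) (auto simp: less_top[symmetric])
  have ST: "\<Phi> -` ((*) w -` box l u) = T ` S"
  proof (rule set_eqI)
    fix v
    have "v = T (vector [Re (w * \<Phi> v), Im (w * \<Phi> v)])"
    proof -
      have *: "\<Phi> (vector [Re (w * \<Phi> v), Im (w * \<Phi> v)]) = w * \<Phi> v"
        by (simp add: \<Phi>_def complex_eq_iff)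
      show ?thesis
        unfolding T_def * mult.assoc[symmetric] mult.commute[of "cnj w"] w2
        by (simp add: \<Phi>_def vec_eq_iff forall_2)
    qed
    moreover have "\<Phi> (vector [Re (w * \<Phi> v), Im (w * \<Phi> v)]) = w * \<Phi> v"
      by (simp add: \<Phi>_def complex_eq_iff)
    ultimately have "w * \<Phi> v \<in> box l u \<Longrightarrow> v \<in> T ` S"
      by (auto simp: S_def intro!: image_eqI)
    moreover have "w * \<Phi> (T x) = \<Phi> x" for x
      unfolding \<Phi>T mult.assoc[symmetric] w2 by simp
    ultimately show "v \<in> \<Phi> -` ((*) w -` box l u) \<longleftrightarrow> v \<in> T ` S"
      by (auto simp: S_def)
  qed
  have op: "open ((*) w -` box l u)"
    by (intro open_vimage open_box continuous_intros)
  have "emeasure (distr lborel borel ((*) w)) (box l u) = emeasure lborel ((*) w -` box l u)"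
    by (subst emeasure_distr) auto
  also have "\<dots> = emeasure lborel (T ` S)"
    unfolding ST[symmetric] using op
    by (subst distr, subst emeasure_distr)
      (use cont in \<open>auto intro: borel_measurable_continuous_onI\<close>)
  also have "\<dots> = emeasure lebesgue (T ` S)"
    unfolding ST[symmetric] using open_vimage[OF op cont] by simp
  also have "\<dots> = emeasure lebesgue S"
    using measurable_orthogonal_image[OF T S] measure_orthogonal_image[OF T S] S
    by (simp add: emeasure_eq_measure2)
  also have "\<dots> = emeasure lborel (box l u)"
    using open_S eS by simp
  also have "\<dots> = (\<Prod>b\<in>Basis. (u - l) \<bullet> b)"
    using le by (rule emeasure_lborel_box)
  finally show "emeasure (distr lborel borel ((*) w)) (box l u) = (\<Prod>b\<in>Basis. (u - l) \<bullet> b)" .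
qed simp

lemma integral_lebesgue_on_eq_lborel:
  fixes f :: "'a::euclidean_space \<Rightarrow> 'b::euclidean_space"
  assumes "f \<in> borel_measurable borel" "S \<in> sets borel"
  shows "(LINT x|lebesgue_on S. f x) = (LINT x|lborel. indicator S x *\<^sub>R f x)"
  using assms by (simp add: integral_restrict_space integral_completion)

lemma integral_unit_ball_rotation:
  fixes f :: "complex \<Rightarrow> complex"
  assumes f: "f \<in> borel_measurable borel" and w: "norm w = 1"
  shows "(LINT z|lebesgue_on (ball 0 1). f (w * z)) = (LINT z|lebesgue_on (ball 0 1). f z)"
proof -
  have [measurable]: "f \<in> borel_measurable borel" by fact
  have "(LINT z|lebesgue_on (ball 0 1). f z) =
      (LINT z|distr lborel borel ((*) w). indicator (ball 0 1) z *\<^sub>R f z)"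
    by (simp add: integral_lebesgue_on_eq_lborel lborel_distr_rotation w del: indicator_simps)
  also have "\<dots> = (LINT z|lborel. indicator (ball 0 1) (w * z) *\<^sub>R f (w * z))"
    by (intro integral_distr borel_measurable_scaleR borel_measurable_indicator f) auto
  also have "\<dots> = (LINT z|lborel. indicator (ball 0 1) z *\<^sub>R f (w * z))"
    by (simp add: indicator_def norm_mult w)
  also have "\<dots> = (LINT z|lebesgue_on (ball 0 1). f (w * z))"
    by (simp add: integral_lebesgue_on_eq_lborel)
  finally show ?thesis ..
qed

text \<open>The points with |z|^2 > x fill an area of pi (1 - x) for 0 <= x <= 1, so |z|^2 is spread
  uniformly over [0,1]. This does the work of polar coordinates.\<close>

lemma distr_unit_ball_norm_square:
  "distr (restrict_space lborel (ball (0::complex) 1)) borel (\<lambda>z. (norm z)\<^sup>2) =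
     density lborel (\<lambda>t. ennreal (pi * indicator {0..1} t))"
  (is "?M = ?N")
proof (rule measure_eqI_lessThan)
  have eq: "emeasure ?M {x<..} = ennreal (pi * (1 - min 1 (max 0 x)))" for x
  proof -
    \<comment> \<open>Clamping x to [0,1] gives one formula for all x. For x < 0 no disk is removed
      at all, not even the origin, although r = 0.\<close>
    define r where "r = sqrt (min 1 (max 0 x))"
    have r: "0 \<le> r" "r \<le> 1" "r\<^sup>2 = min 1 (max 0 x)"
      by (auto simp: r_def)
    have "emeasure ?M {x<..} = emeasure (restrict_space lborel (ball (0::complex) 1))
        ((\<lambda>z. (norm z)\<^sup>2) -` {x<..} \<inter> ball 0 1)"
      by (subst emeasure_distr) (auto simp: space_restrict_space intro!: measurable_restrict_space1)
    also have "(\<lambda>z. (norm z)\<^sup>2) -` {x<..} \<inter> ball 0 1 = ball (0::complex) 1 - (if x < 0 then {} else cball 0 r)"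
    proof -
      have "x < (norm z)\<^sup>2 \<longleftrightarrow> r < norm z" if "norm z < 1" "x \<ge> 0" for z :: complex
      proof -
        have "(norm z)\<^sup>2 < 1" using that by (simp add: power_less_one_iff abs_square_less_1)
        then have "x < (norm z)\<^sup>2 \<longleftrightarrow> r\<^sup>2 < (norm z)\<^sup>2"
          using that by (auto simp: r)
        also have "\<dots> \<longleftrightarrow> r < norm z"
          using r by (meson norm_ge_zero power2_less_imp_less power_strict_mono zero_less_numeral)
        finally show ?thesis .
      qed
      moreover have "x < (norm z)\<^sup>2" if "x < 0" for z :: complex
        using that by (meson less_le_trans zero_le_power2)
      ultimately show ?thesis by (auto simp: not_less not_le)
    qed
    also have "emeasure (restrict_space lborel (ball (0::complex) 1)) \<dots> = emeasure lborel \<dots>"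
      by (rule emeasure_restrict_space) auto
    also have "\<dots> = ennreal (pi * (1 - min 1 (max 0 x)))"
    proof (cases "x < 0")
      case True
      then show ?thesis by (simp add: emeasure_ball unit_ball_vol_2)
    next
      case False
      \<comment> \<open>The boundary circle is a null set, so the closed disk may be exchanged for
        the open one.\<close>
      have "emeasure lborel (ball (0::complex) 1 - cball 0 r) =
          emeasure lborel (ball (0::complex) 1 - ball 0 r)"
      proof (rule emeasure_eq_AE)
        have "AE z in lborel. z \<notin> sphere (0::complex) r"
          by (rule AE_not_in) (auto simp: null_sets_completion_iff[symmetric] 
              negligible_iff_null_sets[symmetric] negligible_sphere)
        then show "AE z in lborel. z \<in> ball (0::complex) 1 - cball 0 r \<longleftrightarrow> z \<in> ball 0 1 - ball 0 r"
          by eventually_elim (auto simp: sphere_def)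
      qed auto
      also have "\<dots> = emeasure lborel (ball (0::complex) 1) - emeasure lborel (ball (0::complex) r)"
        using r by (intro emeasure_Diff) (auto simp: emeasure_ball)
      also have "\<dots> = ennreal (pi * (1 - min 1 (max 0 x)))"
        using r by (simp add: emeasure_ball unit_ball_vol_2 ennreal_minus algebra_simps)
      finally show ?thesis using False by simp
    qed
    finally show ?thesis .
  qed
  have eqN: "emeasure ?N {x<..} = ennreal (pi * (1 - min 1 (max 0 x)))" for x
  proof -
    have "emeasure ?N {x<..} = (\<integral>\<^sup>+t. ennreal pi * indicator ({0..1} \<inter> {x<..}) t \<partial>lborel)"
      by (subst emeasure_density) (auto intro!: nn_integral_cong simp: indicator_def)
    also have "\<dots> = ennreal pi * emeasure lborel ({0..1} \<inter> {x<..})"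
      by (subst nn_integral_cmult) auto
    also have "{0..1} \<inter> {x<..} = (if x < 0 then {0..1} else if x < 1 then {x<..1} else {})"
      by auto
    also have "ennreal pi * emeasure lborel \<dots> = ennreal (pi * (1 - min 1 (max 0 x)))"
      by (auto simp: ennreal_mult)
    finally show ?thesis .
  qed
  show "emeasure ?M {x<..} < \<infinity>" for x unfolding eq by simp
  show "emeasure ?M {x<..} = emeasure ?N {x<..}" for x unfolding eq eqN ..
qed auto

lemma integral_unit_ball_radial:
  fixes g :: "real \<Rightarrow> complex"
  assumes g: "g \<in> borel_measurable borel"
  shows "(LINT z|lebesgue_on (ball (0::complex) 1). g ((norm z)\<^sup>2)) =
    pi *\<^sub>R (LINT t|lborel. indicator {0..1} t *\<^sub>R g t)"
proof -
  have [measurable]: "g \<in> borel_measurable borel" by fact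
  have "(LINT z|lebesgue_on (ball (0::complex) 1). g ((norm z)\<^sup>2)) =
      (LINT z|restrict_space lborel (ball (0::complex) 1). g ((norm z)\<^sup>2))"
    by (subst integral_lebesgue_on_eq_lborel) (auto simp: integral_restrict_space)
  also have "\<dots> = (LINT t|density lborel (\<lambda>t. ennreal (pi * indicator {0..1} t)). g t)"
    unfolding distr_unit_ball_norm_square[symmetric]
    by (rule integral_distr[symmetric]) (auto intro!: measurable_restrict_space1)
  also have "\<dots> = (LINT t|lborel. (pi * indicator {0..1} t) *\<^sub>R g t)"
    by (rule integral_density) auto
  also have "\<dots> = pi *\<^sub>R (LINT t|lborel. indicator {0..1} t *\<^sub>R g t)"
    by (simp flip: integral_scaleR_right scaleR_scaleR)
  finally show ?thesis .
qed

text \<open>For a = b the integrand depends on t = |z|^2 only, and the integral of (1 - t) t^a over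
  [0,1] is 1 / (a + 1) - 1 / (a + 2).\<close>

lemma integral_disk_monomial:
  "(LINT z|lebesgue_on (ball 0 1). (1 - z * cnj z) * (z ^ a * cnj z ^ b)) =
     (if a = b then pi / (of_nat (a + 1) * of_nat (a + 2)) else 0)"
  (is "integral\<^sup>L ?D ?f = _")
proof (cases "a = b")
  case True
  define g :: "real \<Rightarrow> real" where "g t = (1 - t) * t ^ a" for t
  have "?f z = of_real (g ((norm z)\<^sup>2))" for z
    using True
    by (simp add: g_def power_mult_distrib[symmetric] complex_norm_square[symmetric])
  then have "integral\<^sup>L ?D ?f = (LINT z|?D. of_real (g ((norm z)\<^sup>2)))"
    by simp
  also have "\<dots> = pi *\<^sub>R (LINT t|lborel. indicator {0..1} t *\<^sub>R complex_of_real (g t))"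
    by (rule integral_unit_ball_radial) (simp add: g_def)
  also have "(LINT t|lborel. indicator {0..1} t *\<^sub>R complex_of_real (g t)) =
      of_real (LINT t|lborel. g t * indicator {0..1} t)"
    by (subst integral_complex_of_real[symmetric]) (simp add: scaleR_conv_of_real mult.commute)
  also have "(LINT t|lborel. g t * indicator {0..1} t) = 1 / (real (a + 1) * real (a + 2))"
  proof -
    define G where "G t = t ^ Suc a / real (Suc a) - t ^ Suc (Suc a) / real (Suc (Suc a))" for t
    have D: "DERIV (\<lambda>t. t ^ Suc n / real (Suc n)) t :> t ^ n" for n t
      by (rule derivative_eq_intros refl | simp)+
    have "DERIV G t :> t ^ a - t ^ Suc a" for t
      unfolding G_def by (intro DERIV_diff D)
    then have "DERIV G t :> g t" for t
      by (simp add: g_def left_diff_distrib)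
    then have "(LINT t|lborel. g t * indicator {0..1} t) = G 1 - G 0"
      by (intro integral_FTC_Icc_real) (auto simp: g_def)
    also have "\<dots> = 1 / (real (a + 1) * real (a + 2))"
      by (simp add: G_def field_simps)
    finally show ?thesis .
  qed
  finally show ?thesis
    using True by (simp add: scaleR_conv_of_real)
next
  case False
  \<comment> \<open>The angle for which w^a cnj(w)^b = cis pi = -1: rotating by w then shows the
    integral to be its own negative.\<close>
  define w where "w = cis (pi / (real a - real b))"
  have w: "norm w = 1" "w * cnj w = 1"
    by (simp_all add: w_def cis_cnj cis_mult)
  have "w ^ a * cnj w ^ b = cis (real a * (pi / (real a - real b)) - real b * (pi / (real a - real b)))"
    by (simp add: w_def Complex.DeMoivre cis_cnj cis_mult)
  also have "\<dots> = cis pi"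
    using False by (simp add: left_diff_distrib[symmetric] diff_divide_distrib[symmetric])
  finally have ne: "w ^ a * cnj w ^ b = - 1" by simp
  have "integral\<^sup>L ?D ?f = (LINT z|?D. ?f (w * z))"
    by (rule integral_unit_ball_rotation[symmetric])
      (auto simp: w intro!: borel_measurable_continuous_onI continuous_intros)
  also have "?f (w * z) = (w ^ a * cnj w ^ b) * ?f z" for z
    using w by (simp add: power_mult_distrib mult_ac)
  then have "(LINT z|?D. ?f (w * z)) = (w ^ a * cnj w ^ b) * integral\<^sup>L ?D ?f"
    by simp
  finally show ?thesis using ne False by simp
qed

subsection \<open>Orthogonality\<close>

abbreviation disk_weight :: "complex \<Rightarrow> real" where
  "disk_weight z \<equiv> 1 - (Re z)\<^sup>2 - (Im z)\<^sup>2"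

lemma disk_weight_eq: "1 - z * cnj z = of_real (disk_weight z)"
  by (simp add: complex_eq_iff power2_eq_square)

lemma disk_weight_eq_norm: "disk_weight z = 1 - (norm z)\<^sup>2"
  by (simp add: cmod_power2)

lemma disk_weight_pos: "norm z < 1 \<Longrightarrow> disk_weight z > 0"
  unfolding disk_weight_eq_norm by (simp add: abs_square_less_1)

lemma borel_measurable_disk_continuous:
  "continuous_on (ball 0 1) f \<Longrightarrow> f \<in> borel_measurable (lebesgue_on (ball 0 1))"
  by (intro continuous_imp_measurable_on_sets_lebesgue) auto

lemma borel_measurable_disk_weight [measurable]:
  "disk_weight \<in> borel_measurable (lebesgue_on (ball 0 1))"
  by (intro borel_measurable_disk_continuous continuous_intros)

lemma AE_disk_weight_nonneg: "AE z in lebesgue_on (ball 0 1). 0 \<le> 1 / disk_weight z"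
  using disk_weight_pos by (intro AE_I2) (simp add: less_imp_le)

lemma borel_measurable_disk_measure_iff:
  "f \<in> borel_measurable disk_measure \<longleftrightarrow> f \<in> borel_measurable (lebesgue_on (ball 0 1))"
  by (simp add: disk_measure_def)

lemma integral_disk_measure:
  fixes f :: "complex \<Rightarrow> 'b::{banach, second_countable_topology}"
  assumes "f \<in> borel_measurable (lebesgue_on (ball 0 1))"
  shows "(LINT z|disk_measure. f z) =
    (LINT z|lebesgue_on (ball 0 1). (1 / disk_weight z) *\<^sub>R f z)"
  unfolding disk_measure_def
  by (rule integral_density[OF assms _ AE_disk_weight_nonneg]) measurable

lemma integrable_disk_measure_iff:
  fixes f :: "complex \<Rightarrow> 'b::{banach, second_countable_topology}"
  assumes "f \<in> borel_measurable (lebesgue_on (ball 0 1))"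
  shows "integrable disk_measure f \<longleftrightarrow>
    integrable (lebesgue_on (ball 0 1)) (\<lambda>z. (1 / disk_weight z) *\<^sub>R f z)"
  unfolding disk_measure_def
  by (rule integrable_density[OF assms _ AE_disk_weight_nonneg]) measurable

text \<open>The density is strictly positive on the disk, so both measures have the same null
  sets.\<close>

lemma AE_disk_measure_iff:
  "(AE z in disk_measure. P z) \<longleftrightarrow> (AE z in lebesgue_on (ball 0 1). P z)"
proof -
  have "(AE z in disk_measure. P z) \<longleftrightarrow>
      (AE z in lebesgue_on (ball 0 1). 0 < ennreal (1 / disk_weight z) \<longrightarrow> P z)"
    unfolding disk_measure_def by (rule AE_density) measurable
  also have "\<dots> \<longleftrightarrow> (AE z in lebesgue_on (ball 0 1). P z)"
    using disk_weight_pos by (intro AE_cong) simp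
  finally show ?thesis .
qed

lemma finite_measure_unit_ball: "finite_measure (lebesgue_on (ball (0::complex) 1))"
  by (intro finite_measure_lebesgue_on) simp

lemma integrable_disk_continuous:
  fixes f :: "complex \<Rightarrow> 'b::euclidean_space"
  assumes "continuous_on (cball 0 1) f"
  shows "integrable (lebesgue_on (ball 0 1)) f"
proof -
  interpret finite_measure "lebesgue_on (ball (0::complex) 1)"
    by (rule finite_measure_unit_ball)
  have "bounded (f ` cball 0 1)"
    using assms by (intro compact_imp_bounded compact_continuous_image) auto
  then obtain B where "\<forall>y\<in>f ` cball 0 1. norm y \<le> B"
    unfolding bounded_iff by blast
  moreover have "continuous_on (ball 0 1) f"
    using assms ball_subset_cball continuous_on_subset by blast
  ultimately show ?thesis
    by (intro integrable_const_bound[where B = B] AE_I2 borel_measurable_disk_continuous) auto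
qed

text \<open>phi^(p,q) without its factor 1 - |z|^2. In a product of two scattering polynomials that
  factor occurs twice; one copy cancels the singular density and the other remains as a bounded
  weight.\<close>

definition scattering_factor :: "nat \<Rightarrow> nat \<Rightarrow> complex \<Rightarrow> complex" where
  "scattering_factor p q z =
    (-1) ^ p / (of_nat q * fact (p + q - 1)) *
     (\<Sum>k\<le>p + q - 1. scattering_coeff p q k * (z ^ (k - p) * cnj z ^ (k - q)))"

lemma scattering_poly_eq_factor:
  "scattering_poly p q z = of_real (disk_weight z) * scattering_factor p q z"
  unfolding scattering_poly_eq disk_weight_eq scattering_factor_def by simp

lemma continuous_on_scattering_factor [continuous_intros]:
  "continuous_on A (scattering_factor p q)"
  unfolding scattering_factor_def by (intro continuous_intros)

lemma continuous_on_scattering_poly [continuous_intros]: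
  "continuous_on A (scattering_poly p q)"
  unfolding scattering_poly_eq_factor[abs_def] by (intro continuous_intros)

lemma scattering_poly_in_L2: "scattering_poly p q \<in> L2 disk_measure"
proof -
  have meas: "scattering_poly p q \<in> borel_measurable (lebesgue_on (ball 0 1))"
    by (intro borel_measurable_disk_continuous continuous_intros)
  have "integrable (lebesgue_on (ball 0 1))
      (\<lambda>z. disk_weight z * (norm (scattering_factor p q z))\<^sup>2)"
    by (intro integrable_disk_continuous continuous_intros)
  also have "?this \<longleftrightarrow> integrable (lebesgue_on (ball 0 1))
      (\<lambda>z. (1 / disk_weight z) *\<^sub>R (norm (scattering_poly p q z))\<^sup>2)"
  proof (intro Bochner_Integration.integrable_cong refl)
    fix z :: complex
    assume "z \<in> space (lebesgue_on (ball 0 1))"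
    then have "disk_weight z > 0" by (intro disk_weight_pos) simp
    then show "disk_weight z * (norm (scattering_factor p q z))\<^sup>2 =
        (1 / disk_weight z) *\<^sub>R (norm (scattering_poly p q z))\<^sup>2"
      unfolding scattering_poly_eq_factor norm_mult norm_of_real power_mult_distrib power2_abs
      by (simp add: power2_eq_square)
  qed
  finally show ?thesis
    using meas by (simp add: L2_def borel_measurable_disk_measure_iff integrable_disk_measure_iff)
qed

text \<open>By continuity the nonzero set is open, hence empty once it is negligible. On the real
  points of (0,1) the cofactor would then be, up to a nonzero constant, a one-variable polynomial
  with infinitely many roots, against its nonzero top coefficient.\<close>

lemma scattering_poly_not_AE_0:
  assumes pq: "p \<ge> 1" "q \<ge> 1"
  shows "\<not> (AE z in disk_measure. scattering_poly p q z = 0)"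
proof
  assume "AE z in disk_measure. scattering_poly p q z = 0"
  then have "AE z in lebesgue. z \<in> ball 0 1 \<longrightarrow> scattering_poly p q z = 0"
    by (simp add: AE_disk_measure_iff AE_restrict_space_iff)
  then have "negligible {z \<in> ball 0 1. scattering_poly p q z \<noteq> 0}"
    by (simp add: negligible_iff_null_sets AE_iff_null_sets[symmetric] eventually_ae_filter)
      (smt (verit) Collect_cong mem_Collect_eq null_sets_completion_subset subset_eq)
  moreover have "open {z \<in> ball 0 1. scattering_poly p q z \<noteq> 0}"
  proof -
    have "{z \<in> ball 0 1. scattering_poly p q z \<noteq> 0} =
        ball 0 1 \<inter> scattering_poly p q -` (- {0})"
      by auto
    also have "open \<dots>"
      by (intro continuous_open_preimage continuous_intros) auto
    finally show ?thesis .
  qed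
  ultimately have "{z \<in> ball 0 1. scattering_poly p q z \<noteq> 0} = {}"
    using open_not_negligible by blast
  then have zero: "scattering_factor p q z = 0" if "norm z < 1" for z
  proof -
    have "of_real (disk_weight z) * scattering_factor p q z = 0"
      unfolding scattering_poly_eq_factor[symmetric]
      using \<open>{z \<in> ball 0 1. scattering_poly p q z \<noteq> 0} = {}\<close> that by auto
    then show ?thesis
      using disk_weight_pos[OF that] unfolding mult_eq_0_iff of_real_eq_0_iff by auto
  qed
  \<comment> \<open>From max p q on, 2 k - p - q = (k - p) + (k - q) holds without truncation, and
    different k give different exponents.\<close>
  define P where "P = (\<Sum>k\<in>{max p q..p + q - 1}. monom (scattering_coeff p q k) (2 * k - p - q))"
  have "poly P (of_real x) = 0" if x: "0 < x" "x < 1" for x :: real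
  proof -
    have "poly P (of_real x) = (\<Sum>k\<in>{max p q..p + q - 1}. scattering_coeff p q k *
        (of_real x ^ (k - p) * cnj (of_real x) ^ (k - q)))"
      unfolding P_def poly_sum poly_monom
    proof (intro sum.cong refl)
      fix k
      assume "k \<in> {max p q..p + q - 1}"
      then have "2 * k - p - q = (k - p) + (k - q)" by auto
      then show "scattering_coeff p q k * complex_of_real x ^ (2 * k - p - q) =
          scattering_coeff p q k * (of_real x ^ (k - p) * cnj (of_real x) ^ (k - q))"
        by (simp add: power_add)
    qed
    also have "\<dots> = (\<Sum>k\<le>p + q - 1. scattering_coeff p q k *
        (of_real x ^ (k - p) * cnj (of_real x) ^ (k - q)))"
      by (intro sum.mono_neutral_left) (auto simp: scattering_coeff_eq_0 not_le)
    also have "\<dots> = 0"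
      using zero[of "of_real x"] x pq by (simp add: scattering_factor_def)
    finally show ?thesis .
  qed
  then have "complex_of_real ` {0<..<1} \<subseteq> {x. poly P x = 0}" by auto
  moreover have "infinite (complex_of_real ` {0<..<1})"
    by (subst finite_image_iff) (auto simp: inj_on_def)
  ultimately have "P = 0"
    using poly_roots_finite finite_subset by blast
  have "coeff P (p + q - 2) = (\<Sum>k\<in>{max p q..p + q - 1}.
      if k = p + q - 1 then scattering_coeff p q k else 0)"
    unfolding P_def coeff_sum using pq by (intro sum.cong) auto
  also have "\<dots> = scattering_coeff p q (p + q - 1)"
    using pq by (subst sum.delta) auto
  finally show False
    using \<open>P = 0\<close> scattering_coeff_top_neq_0[OF pq] by simp
qed

text \<open>Conjugating the second polynomial swaps its exponents, so l - t joins the power of z.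
  With the sum over k inside, each l pairs phi^(p,q) with one monomial. The constant stays anonymous
  since only vanishing matters.\<close>

lemma l2_inner_scattering_poly:
  "\<exists>C. l2_inner disk_measure (scattering_poly p q) (scattering_poly s t) =
    C * (\<Sum>l\<le>s + t - 1. scattering_coeff s t l * (\<Sum>k\<le>p + q - 1. scattering_coeff p q k *
      (LINT z|lebesgue_on (ball 0 1). (1 - z * cnj z) *
         (z ^ (k - p + (l - t)) * cnj z ^ (k - q + (l - s))))))"
proof
  define C1 :: complex where "C1 = (-1) ^ p / (of_nat q * fact (p + q - 1))"
  define C2 :: complex where "C2 = (-1) ^ s / (of_nat t * fact (s + t - 1))"
  let ?D = "lebesgue_on (ball (0::complex) 1)"
  let ?f = "\<lambda>l k z. (1 - z * cnj z) * (z ^ (k - p + (l - t)) * cnj z ^ (k - q + (l - s)))"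
  have C2: "cnj C2 = C2" by (simp add: C2_def)
  have int: "integrable ?D (?f l k)" for l k
    by (intro integrable_disk_continuous continuous_intros)
  have "l2_inner disk_measure (scattering_poly p q) (scattering_poly s t) =
      (LINT z|?D. (1 / disk_weight z) *\<^sub>R (scattering_poly p q z * cnj (scattering_poly s t z)))"
    unfolding l2_inner_def
    by (intro integral_disk_measure borel_measurable_disk_continuous continuous_intros)
  also have "\<dots> = (LINT z|?D. (C1 * C2) * (\<Sum>l\<le>s + t - 1. scattering_coeff s t l *
      (\<Sum>k\<le>p + q - 1. scattering_coeff p q k * ?f l k z)))"
  proof (intro Bochner_Integration.integral_cong refl)
    fix z :: complex
    assume "z \<in> space ?D"
    then have w: "disk_weight z > 0" by (intro disk_weight_pos) simp
    have "(1 / disk_weight z) *\<^sub>R (scattering_poly p q z * cnj (scattering_poly s t z)) =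
        (1 - z * cnj z) * (scattering_factor p q z * cnj (scattering_factor s t z))"
      using w unfolding scattering_poly_eq_factor disk_weight_eq
      by (simp add: scaleR_conv_of_real del: of_real_diff of_real_power)
    also have "\<dots> = (C1 * C2) * (\<Sum>l\<le>s + t - 1. scattering_coeff s t l *
      (\<Sum>k\<le>p + q - 1. scattering_coeff p q k * ?f l k z))"
      unfolding scattering_factor_def C1_def[symmetric] C2_def[symmetric]
      by (simp add: sum_distrib_left sum_distrib_right C2 power_add mult_ac)
    finally show "(1 / disk_weight z) *\<^sub>R (scattering_poly p q z * cnj (scattering_poly s t z)) =
      (C1 * C2) * (\<Sum>l\<le>s + t - 1. scattering_coeff s t l *
      (\<Sum>k\<le>p + q - 1. scattering_coeff p q k * ?f l k z))" .
  qed
  also have "\<dots> = (C1 * C2) * (\<Sum>l\<le>s + t - 1. scattering_coeff s t l *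
      (\<Sum>k\<le>p + q - 1. scattering_coeff p q k * (LINT z|?D. ?f l k z)))"
    by (simp only: integral_mult_right_zero Bochner_Integration.integral_sum
      Bochner_Integration.integrable_sum integrable_mult_right int)
  finally show "l2_inner disk_measure (scattering_poly p q) (scattering_poly s t) =
    (C1 * C2) * (\<Sum>l\<le>s + t - 1. scattering_coeff s t l *
      (\<Sum>k\<le>p + q - 1. scattering_coeff p q k * (LINT z|?D. ?f l k z)))" .
qed

lemma l2_inner_commute: "l2_inner M g f = cnj (l2_inner M f g)"
proof -
  have "(\<lambda>x. g x * cnj (f x)) = (\<lambda>x. cnj (f x * cnj (g x)))"
    by (simp add: mult.commute)
  then show ?thesis
    unfolding l2_inner_def by (simp only: Bochner_Integration.integral_cnj)
qed

text \<open>Either the angular degrees differ and every integral with a nonzero coefficient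
  vanishes, or each monomial of the second polynomial is low enough for
  \<open>scattering_coeff_alternating_sum\<close>.\<close>

lemma scattering_poly_orthogonal_aux:
  assumes "p + t \<noteq> q + s \<or> (1 \<le> s \<and> 1 \<le> t \<and> s < p \<and> t < q)"
  shows "l2_inner disk_measure (scattering_poly p q) (scattering_poly s t) = 0"
proof -
  have "scattering_coeff s t l * (\<Sum>k\<le>p + q - 1. scattering_coeff p q k *
      (LINT z|lebesgue_on (ball 0 1). (1 - z * cnj z) *
         (z ^ (k - p + (l - t)) * cnj z ^ (k - q + (l - s))))) = 0" 
    (is "_ * ?S = 0") if l: "l \<le> s + t - 1" for l
  proof (cases "l < s \<or> l < t")
    case True
    then show ?thesis by (simp add: scattering_coeff_eq_0)
  next
    case False
    have "?S = (\<Sum>k\<le>p + q - 1. of_bool (p + t = q + s) * pi * (scattering_coeff p q k *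
        (1 / (of_nat (k - p + (l - t) + 1) * of_nat (k - p + (l - t) + 2)))))"
    proof (intro sum.cong refl)
      fix k
      show "scattering_coeff p q k *
      (LINT z|lebesgue_on (ball 0 1). (1 - z * cnj z) *
         (z ^ (k - p + (l - t)) * cnj z ^ (k - q + (l - s)))) =
        of_bool (p + t = q + s) * pi * (scattering_coeff p q k *
        (1 / (of_nat (k - p + (l - t) + 1) * of_nat (k - p + (l - t) + 2))))"
      \<comment> \<open>Equal exponents mean p + t = q + s only where no subtraction truncates; for
        the other k the coefficient is 0.\<close>
      proof (cases "k < p \<or> k < q")
        case True
        then show ?thesis by (simp add: scattering_coeff_eq_0)
      next
        case False
        with \<open>\<not> (l < s \<or> l < t)\<close>
        have "k - p + (l - t) = k - q + (l - s) \<longleftrightarrow> p + t = q + s" by auto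
        then show ?thesis unfolding integral_disk_monomial by simp
      qed
    qed
    also have "\<dots> = 0"
    proof (cases "p + t = q + s")
      case True
      \<comment> \<open>From l <= s + t - 1 follow l - t <= s - 1 <= p - 2 and l - s <= t - 1 <= q -
        2.\<close>
      with assms False l have "(l - t) + 2 \<le> p" "(l - s) + 2 \<le> q" "p + (l - s) = q + (l - t)"
        by auto
      from scattering_coeff_alternating_sum[OF this] show ?thesis
        by (simp only: sum_distrib_left[symmetric] mult_zero_right)
    qed simp
    finally show ?thesis by simp
  qed
  then have "(\<Sum>l\<le>s + t - 1. scattering_coeff s t l * (\<Sum>k\<le>p + q - 1. scattering_coeff p q k *
      (LINT z|lebesgue_on (ball 0 1). (1 - z * cnj z) *
         (z ^ (k - p + (l - t)) * cnj z ^ (k - q + (l - s)))))) = 0"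
    by (intro sum.neutral) simp
  with l2_inner_scattering_poly[of p q s t] show ?thesis
    by (metis mult_zero_right)
qed

text \<open>If p - q = s - t, distinct pairs are strictly ordered in both coordinates at once;
  conjugate symmetry allows either order.\<close>

lemma scattering_poly_orthogonal:
  assumes "(p, q) \<noteq> (s, t)" and "p \<ge> 1" "q \<ge> 1" "s \<ge> 1" "t \<ge> 1"
  shows "l2_inner disk_measure (scattering_poly p q) (scattering_poly s t) = 0"
proof -
  consider "p + t \<noteq> q + s" | "s < p" "t < q" | "p < s" "q < t"
    using assms(1) by fastforce
  then show ?thesis
  proof cases
    case 3
    then show ?thesis
      using scattering_poly_orthogonal_aux[of s q t p] assms by (subst l2_inner_commute) simp
  qed (use assms in \<open>auto intro: scattering_poly_orthogonal_aux\<close>)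
qed

subsection \<open>Completeness\<close>

lemma complex_span_base: "i \<in> I \<Longrightarrow> e i \<in> complex_span I e"
  unfolding complex_span_def
  by (intro CollectI exI[of _ "{i}"] exI[of _ "\<lambda>_. 1"]) (simp add: fun_eq_iff)

lemma complex_span_zero: "(\<lambda>_. 0) \<in> complex_span I e"
  unfolding complex_span_def by (intro CollectI exI[of _ "{}"]) simp

lemma complex_span_scale:
  assumes "f \<in> complex_span I e"
  shows "(\<lambda>x. a * f x) \<in> complex_span I e"
proof -
  obtain F c where "f = (\<lambda>x. \<Sum>i\<in>F. c i * e i x)" "finite F" "F \<subseteq> I"
    using assms by (auto simp: complex_span_def)
  then show ?thesis
    unfolding complex_span_def
    by (intro CollectI exI[of _ F] exI[of _ "\<lambda>i. a * c i"]) (simp add: sum_distrib_left mult.assoc)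
qed

lemma complex_span_add:
  assumes "f \<in> complex_span I e" "g \<in> complex_span I e"
  shows "(\<lambda>x. f x + g x) \<in> complex_span I e"
proof -
  obtain F c where F: "f = (\<lambda>x. \<Sum>i\<in>F. c i * e i x)" "finite F" "F \<subseteq> I"
    using assms(1) by (auto simp: complex_span_def)
  obtain G d where G: "g = (\<lambda>x. \<Sum>i\<in>G. d i * e i x)" "finite G" "G \<subseteq> I"
    using assms(2) by (auto simp: complex_span_def)
  have "(\<Sum>i\<in>F. c i * e i x) = (\<Sum>i\<in>F \<union> G. (if i \<in> F then c i else 0) * e i x)" for x
    using F G by (intro sum.mono_neutral_cong_left) auto
  moreover have "(\<Sum>i\<in>G. d i * e i x) = (\<Sum>i\<in>F \<union> G. (if i \<in> G then d i else 0) * e i x)" for x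
    using F G by (intro sum.mono_neutral_cong_left) auto
  ultimately have "(\<lambda>x. f x + g x) =
      (\<lambda>x. \<Sum>i\<in>F \<union> G. ((if i \<in> F then c i else 0) + (if i \<in> G then d i else 0)) * e i x)"
    unfolding F(1) G(1) by (simp add: sum.distrib[symmetric] distrib_right)
  then show ?thesis
    unfolding complex_span_def mem_Collect_eq using F(2,3) G(2,3)
    by (intro exI[of _ "F \<union> G"]
      exI[of _ "\<lambda>i. (if i \<in> F then c i else 0) + (if i \<in> G then d i else 0)"]) simp
qed

lemma complex_span_sum:
  assumes "\<And>a. a \<in> A \<Longrightarrow> f a \<in> complex_span I e"
  shows "(\<lambda>x. \<Sum>a\<in>A. f a x) \<in> complex_span I e"
  using assms
  by (induction A rule: infinite_finite_induct)
    (simp_all add: complex_span_zero complex_span_add)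

text \<open>Strong induction on the degree: the top term k = a + b + 1 of phi^(b+1,a+1) is a nonzero
  multiple of the wanted function, and all other nonzero terms have lower degree. The indices are
  crossed because p counts the z-derivatives.\<close>

lemma disk_weight_monomial_in_span:
  "(\<lambda>z. (1 - z * cnj z) * (z ^ a * cnj z ^ b)) \<in>
     complex_span {(p, q). min p q \<ge> 1} (\<lambda>(p, q). scattering_poly p q)"
  (is "_ \<in> ?S")
proof (induction "a + b" arbitrary: a b rule: less_induct)
  case less
  define m where "m = a + b + 1"
  define A where "A = scattering_coeff (b + 1) (a + 1)"
  define C :: complex where "C = (-1) ^ (b + 1) / (of_nat (a + 1) * fact m)"
  let ?g = "\<lambda>k z. (1 - z * cnj z) * (z ^ (k - (b + 1)) * cnj z ^ (k - (a + 1)))"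
  have A0: "A m \<noteq> 0"
    using scattering_coeff_top_neq_0[of "b + 1" "a + 1"] by (simp add: A_def m_def add.commute)
  have C0: "C \<noteq> 0" by (simp add: C_def del: of_nat_add of_nat_Suc)
  have m: "b + 1 + (a + 1) - 1 = m" by (simp add: m_def)
  have phi: "scattering_poly (b + 1) (a + 1) z = C * ((\<Sum>k<m. A k * ?g k z) +
      A m * ((1 - z * cnj z) * (z ^ a * cnj z ^ b)))" for z
  proof -
    have exps: "m - (b + 1) = a" "m - (a + 1) = b"
      by (auto simp: m_def)
    have "(\<Sum>k<m. A k * ?g k z) =
        (1 - z * cnj z) * (\<Sum>k<m. A k * (z ^ (k - (b + 1)) * cnj z ^ (k - (a + 1))))"
      unfolding sum_distrib_left by (intro sum.cong refl mult.left_commute)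
    moreover have "C * w * (S + Am * Y) = C * (w * S + Am * (w * Y))" for w S Am Y
      by (simp add: algebra_simps)
    ultimately show ?thesis
      unfolding scattering_poly_eq m A_def[symmetric] C_def[symmetric]
        lessThan_Suc_atMost[symmetric] sum.lessThan_Suc exps by simp
  qed
  have eq: "(\<lambda>z. (1 - z * cnj z) * (z ^ a * cnj z ^ b)) =
      (\<lambda>z. 1 / (C * A m) * scattering_poly (b + 1) (a + 1) z +
         (- 1 / A m) * (\<Sum>k<m. A k * ?g k z))"
  proof (intro ext)
    fix z
    have "x = 1 / (C * A m) * (C * (S + A m * x)) + (- 1 / A m) * S" for x S
      using A0 C0 by (simp add: field_simps)
    then show "(1 - z * cnj z) * (z ^ a * cnj z ^ b) =
        1 / (C * A m) * scattering_poly (b + 1) (a + 1) z + (- 1 / A m) * (\<Sum>k<m. A k * ?g k z)"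
      unfolding phi .
  qed
  have top: "scattering_poly (b + 1) (a + 1) \<in> ?S"
    using complex_span_base[of "(b + 1, a + 1)" "{(p, q). min p q \<ge> 1}" "\<lambda>(p, q). scattering_poly p q"]
    by simp
  have lower: "(\<lambda>z. A k * ?g k z) \<in> ?S" if "k \<in> {..<m}" for k
  \<comment> \<open>The base case a = b = 0 rests on the first alternative: its only lower index k =
    0 has coefficient 0.\<close>
  proof (cases "k < b + 1 \<or> k < a + 1")
    case True
    then have "A k = 0" by (simp add: A_def scattering_coeff_eq_0)
    then show ?thesis by (simp add: complex_span_zero)
  next
    case False
    with that have "(k - (b + 1)) + (k - (a + 1)) < a + b" by (auto simp: m_def)
    from less[OF this] show ?thesis by (rule complex_span_scale)
  qed
  show ?case
    unfolding eq
    by (rule complex_span_add[OF complex_span_scale[OF top] complex_span_scale[OF complex_span_sum[OF lower]]])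
qed

text \<open>Polynomials in z and cnj(z), written as a span so that the closure properties of
  \<open>complex_span\<close> apply.\<close>

definition zpoly :: "(complex \<Rightarrow> complex) set" where
  "zpoly = complex_span UNIV (\<lambda>(a, b) z. z ^ a * cnj z ^ b)"

lemma zpoly_monomial: "(\<lambda>z. z ^ a * cnj z ^ b) \<in> zpoly"
  using complex_span_base[of "(a, b)" UNIV "\<lambda>(a, b) z. z ^ a * cnj z ^ b"]
  by (simp add: zpoly_def)

lemma zpoly_mult:
  assumes "f \<in> zpoly" "g \<in> zpoly"
  shows "(\<lambda>z. f z * g z) \<in> zpoly"
proof -
  obtain F c where F: "f = (\<lambda>z. \<Sum>(a, b)\<in>F. c (a, b) * (z ^ a * cnj z ^ b))"
    using assms(1) by (auto simp: zpoly_def complex_span_def case_prod_beta')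
  obtain G d where G: "g = (\<lambda>z. \<Sum>(a, b)\<in>G. d (a, b) * (z ^ a * cnj z ^ b))"
    using assms(2) by (auto simp: zpoly_def complex_span_def case_prod_beta')
  have "(\<lambda>z. f z * g z) = (\<lambda>z. \<Sum>i\<in>F. \<Sum>j\<in>G. c i * d j * 
      (z ^ (fst i + fst j) * cnj z ^ (snd i + snd j)))"
    unfolding F G sum_product
    by (intro ext sum.cong) (auto simp: power_add mult_ac)
  also have "\<dots> \<in> zpoly"
    unfolding zpoly_def
    by (intro complex_span_sum complex_span_scale zpoly_monomial[unfolded zpoly_def])
  finally show ?thesis .
qed

lemma zpoly_const: "(\<lambda>_. c) \<in> zpoly"
  using complex_span_scale[OF zpoly_monomial[of 0 0, unfolded zpoly_def], of c]
  by (simp add: zpoly_def)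

lemma zpoly_real_polynomial_function:
  assumes "real_polynomial_function f"
  shows "(\<lambda>z. complex_of_real (f z)) \<in> zpoly"
  using assms
proof induction
  case (linear f)
  interpret bounded_linear f by fact
  have fz: "f z = Re z * f 1 + Im z * f \<i>" for z
  proof -
    have "z = Re z *\<^sub>R 1 + Im z *\<^sub>R \<i>"
      by (simp add: complex_eq_iff)
    then have "f z = f (Re z *\<^sub>R 1 + Im z *\<^sub>R \<i>)"
      by (rule arg_cong)
    also have "\<dots> = Re z * f 1 + Im z * f \<i>"
      by (simp only: add scale real_scaleR_def)
    finally show ?thesis .
  qed
  \<comment> \<open>Substitute Re z = (z + cnj z) / 2 and Im z = (z - cnj z) / (2 i).\<close>
  have "(\<lambda>z. complex_of_real (f z)) =
      (\<lambda>z. (f 1 - \<i> * f \<i>) / 2 * (z ^ 1 * cnj z ^ 0) + (f 1 + \<i> * f \<i>) / 2 * (z ^ 0 * cnj z ^ 1))"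
  proof
    fix z
    show "complex_of_real (f z) =
      (f 1 - \<i> * f \<i>) / 2 * (z ^ 1 * cnj z ^ 0) + (f 1 + \<i> * f \<i>) / 2 * (z ^ 0 * cnj z ^ 1)"
      by (subst fz) (simp add: complex_eq_iff field_simps)
  qed
  also have "\<dots> \<in> zpoly"
    unfolding zpoly_def
    by (intro complex_span_add complex_span_scale zpoly_monomial[unfolded zpoly_def])
  finally show ?case .
next
  case (const c)
  show ?case by (rule zpoly_const)
next
  case (add f g)
  then show ?case
    using complex_span_add unfolding zpoly_def by simp
next
  case (mult f g)
  then show ?case using zpoly_mult by simp
qed

text \<open>Stone-Weierstrass yields a \<open>polynomial_function\<close> on the real plane; this
  rewrites it in z and cnj(z).\<close>

lemma zpoly_polynomial_function:
  assumes "polynomial_function g"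
  shows "g \<in> zpoly"
proof -
  have "real_polynomial_function (Re \<circ> g)" "real_polynomial_function (Im \<circ> g)"
    using assms bounded_linear_Re bounded_linear_Im by (auto simp: polynomial_function_def)
  then have "(\<lambda>z. complex_of_real (Re (g z)) + \<i> * complex_of_real (Im (g z))) \<in> zpoly"
    using zpoly_real_polynomial_function unfolding zpoly_def
    by (intro complex_span_add complex_span_scale) (auto simp: o_def)
  then show ?thesis
    by (simp add: complex_eq[symmetric])
qed

lemma disk_weight_zpoly_in_span:
  assumes "P \<in> zpoly"
  shows "(\<lambda>z. of_real (disk_weight z) * P z) \<in>
    complex_span {(p, q). min p q \<ge> 1} (\<lambda>(p, q). scattering_poly p q)"
proof -
  obtain F c where F: "P = (\<lambda>z. \<Sum>(a, b)\<in>F. c (a, b) * (z ^ a * cnj z ^ b))"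
    using assms by (auto simp: zpoly_def complex_span_def case_prod_beta')
  have "(\<lambda>z. of_real (disk_weight z) * P z) =
      (\<lambda>z. \<Sum>i\<in>F. c i * ((1 - z * cnj z) * (z ^ fst i * cnj z ^ snd i)))"
    unfolding F disk_weight_eq[symmetric] sum_distrib_left
    by (intro ext sum.cong) (auto simp: mult_ac)
  then show ?thesis
    by (simp only:) (intro complex_span_sum complex_span_scale disk_weight_monomial_in_span)
qed

lemma zpoly_continuous_on:
  assumes "P \<in> zpoly"
  shows "continuous_on A P"
proof -
  obtain F c where "P = (\<lambda>z. \<Sum>(a, b)\<in>F. c (a, b) * (z ^ a * cnj z ^ b))"
    using assms by (auto simp: zpoly_def complex_span_def case_prod_beta')
  then show ?thesis
    by (simp only: case_prod_unfold) (intro continuous_intros)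
qed

section \<open>Density of polynomials in the weighted space\<close>

lemma disk_weight_le_1: "disk_weight z \<le> 1"
  by (simp add: disk_weight_eq_norm)

text \<open>Setting F to 0 where |F| > n changes nothing at a given point once n is large, and the
  weighted |F|^2 dominates all the errors.\<close>

lemma truncation_weighted_L2:
  fixes F :: "complex \<Rightarrow> complex"
  assumes F [measurable]: "F \<in> borel_measurable (lebesgue_on (ball 0 1))"
    and int: "integrable (lebesgue_on (ball 0 1)) (\<lambda>z. disk_weight z * (norm (F z))\<^sup>2)"
    and "\<epsilon> > 0"
  obtains G and n :: nat where "G \<in> borel_measurable (lebesgue_on (ball 0 1))"
    "\<forall>z. norm (G z) \<le> real n"
    "integrable (lebesgue_on (ball 0 1)) (\<lambda>z. disk_weight z * (norm (F z - G z))\<^sup>2)"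
    "(LINT z|lebesgue_on (ball 0 1). disk_weight z * (norm (F z - G z))\<^sup>2) < \<epsilon>"
proof -
  let ?D = "lebesgue_on (ball (0::complex) 1)"
  define T where "T n z = (if norm (F z) \<le> real n then F z else 0)" for n z
  have T [measurable]: "T n \<in> borel_measurable ?D" for n
    unfolding T_def by measurable
  have bound: "norm (disk_weight z * (norm (F z - T n z))\<^sup>2) \<le> disk_weight z * (norm (F z))\<^sup>2"
    if "z \<in> space ?D" for n z
    using that disk_weight_pos[of z] by (auto simp: T_def)
  have "(\<lambda>n. LINT z|?D. disk_weight z * (norm (F z - T n z))\<^sup>2) \<longlonglongrightarrow> (LINT z|?D. 0)"
  proof (rule integral_dominated_convergence[OF _ _ int])
    have "\<forall>\<^sub>F n in sequentially. T n z = F z" for z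
    proof -
      obtain N :: nat where "norm (F z) \<le> N" using real_arch_simple by blast
      then show ?thesis
        by (intro eventually_sequentiallyI[of N]) (auto simp: T_def)
    qed
    then have "\<forall>\<^sub>F n in sequentially. disk_weight z * (norm (F z - T n z))\<^sup>2 = 0" for z
      by (rule eventually_mono[of "\<lambda>n. T n z = F z"]) simp
    then show "AE z in ?D. (\<lambda>n. disk_weight z * (norm (F z - T n z))\<^sup>2) \<longlonglongrightarrow> 0"
      by (intro AE_I2 tendsto_eventually)
    show "AE z in ?D. norm (disk_weight z * (norm (F z - T n z))\<^sup>2) \<le> disk_weight z * (norm (F z))\<^sup>2" for n
      using bound by (intro AE_I2)
  qed measurable
  then have "\<forall>\<^sub>F n in sequentially. (LINT z|?D. disk_weight z * (norm (F z - T n z))\<^sup>2) < \<epsilon>"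
    using \<open>\<epsilon> > 0\<close> by (simp add: order_tendstoD(2))
  then obtain n where "(LINT z|?D. disk_weight z * (norm (F z - T n z))\<^sup>2) < \<epsilon>"
    by (auto simp: eventually_sequentially)
  moreover have "integrable ?D (\<lambda>z. disk_weight z * (norm (F z - T n z))\<^sup>2)"
  proof (rule Bochner_Integration.integrable_bound[OF int])
    show "AE z in ?D. norm (disk_weight z * (norm (F z - T n z))\<^sup>2) \<le> norm (disk_weight z * (norm (F z))\<^sup>2)"
    proof (intro AE_I2)
      fix z assume "z \<in> space ?D"
      from bound[OF this, of n] show
        "norm (disk_weight z * (norm (F z - T n z))\<^sup>2) \<le> norm (disk_weight z * (norm (F z))\<^sup>2)"
        unfolding real_norm_def by (rule order_trans) (rule abs_ge_self)
    qed
  qed measurable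
  moreover have "norm (T n z) \<le> n" for z
    by (simp add: T_def)
  ultimately show thesis
    using that[of "T n" n] T by simp
qed

text \<open>Measurability gives continuous functions converging to G almost everywhere, but with no
  common bound. Clipping their values supplies one, and a constant dominates on a disk of finite
  area.\<close>

lemma continuous_approx_weighted_L2:
  fixes G :: "complex \<Rightarrow> complex"
  assumes G [measurable]: "G \<in> borel_measurable (lebesgue_on (ball 0 1))"
    and bd: "\<forall>z. norm (G z) \<le> B" and "\<epsilon> > 0"
  obtains h :: "complex \<Rightarrow> complex" where "continuous_on UNIV h"
    "integrable (lebesgue_on (ball 0 1)) (\<lambda>z. disk_weight z * (norm (G z - h z))\<^sup>2)"
    "(LINT z|lebesgue_on (ball 0 1). disk_weight z * (norm (G z - h z))\<^sup>2) < \<epsilon>"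
proof -
  let ?D = "lebesgue_on (ball (0::complex) 1)"
  interpret finite_measure ?D by (rule finite_measure_unit_ball)
  have B: "0 \<le> B" using norm_ge_zero bd order_trans by blast
  \<comment> \<open>Radial retraction onto the closed disk of radius B + 1. It fixes the values of
    G, so limits survive; the added 1 keeps the denominator positive even for B = 0.\<close>
  define clip :: "complex \<Rightarrow> complex" where "clip y = ((B + 1) / max (B + 1) (norm y)) *\<^sub>R y" for y
  have cont_clip: "continuous_on UNIV clip"
    unfolding clip_def using B by (intro continuous_intros) (auto simp: max_def)
  have norm_clip: "norm (clip y) \<le> B + 1" for y
  proof (cases "B + 1 \<le> norm y")
    case True
    then have "norm y > 0" using B by linarith
    with True B show ?thesis by (simp add: clip_def max_def)
  qed (use B in \<open>simp add: clip_def max_def\<close>)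
  have clip_id: "clip y = y" if "norm y \<le> B" for y
    using that B by (simp add: clip_def max_def)
  have "G measurable_on ball 0 1"
    using G by (simp add: measurable_on_iff_borel_measurable)
  then obtain N g where N: "negligible N" and g: "\<And>n. continuous_on UNIV (g n)"
    and lim: "\<And>z. z \<notin> N \<Longrightarrow> (\<lambda>n. g n z) \<longlonglongrightarrow> (if z \<in> ball 0 1 then G z else 0)"
    unfolding measurable_on_def by blast
  define h where "h n z = clip (g n z)" for n z
  have cont_h: "continuous_on UNIV (h n)" for n
    unfolding h_def using continuous_on_compose2[OF cont_clip g] by simp
  then have [measurable]: "h n \<in> borel_measurable ?D" for n
    by (intro borel_measurable_disk_continuous) (auto intro: continuous_on_subset)
  have bound: "norm (disk_weight z * (norm (G z - h n z))\<^sup>2) \<le> (B + (B + 1))\<^sup>2"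
    if "z \<in> space ?D" for n z
  proof -
    have "norm (G z - h n z) \<le> B + (B + 1)"
      using norm_triangle_le_diff[of "G z" "h n z"] add_mono[OF bd[rule_format, of z] norm_clip[of "g n z"]]
      by (simp add: h_def)
    then have "(norm (G z - h n z))\<^sup>2 \<le> (B + (B + 1))\<^sup>2"
      by (intro power_mono) auto
    moreover have "0 < disk_weight z" "disk_weight z \<le> 1"
      using that disk_weight_pos[of z] disk_weight_le_1 by auto
    ultimately have "disk_weight z * (norm (G z - h n z))\<^sup>2 \<le> 1 * (B + (B + 1))\<^sup>2"
      by (intro mult_mono) auto
    then show ?thesis using \<open>0 < disk_weight z\<close> by (simp add: abs_mult)
  qed
  have AE_N: "AE z in ?D. z \<notin> N"
  proof -
    have "AE z in lebesgue. z \<notin> N"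
      using N by (intro AE_not_in) (simp add: negligible_iff_null_sets)
    then show ?thesis
      by (auto simp: AE_restrict_space_iff elim: eventually_mono)
  qed
  have "(\<lambda>n. LINT z|?D. disk_weight z * (norm (G z - h n z))\<^sup>2) \<longlonglongrightarrow> (LINT z|?D. 0)"
  proof (rule integral_dominated_convergence)
    show "integrable ?D (\<lambda>z. (B + (B + 1))\<^sup>2)" by simp
    show "AE z in ?D. norm (disk_weight z * (norm (G z - h n z))\<^sup>2) \<le> (B + (B + 1))\<^sup>2" for n
      using bound by (intro AE_I2)
    show "AE z in ?D. (\<lambda>n. disk_weight z * (norm (G z - h n z))\<^sup>2) \<longlonglongrightarrow> 0"
      using AE_N AE_space
    proof eventually_elim
      case (elim z)
      then have "(\<lambda>n. g n z) \<longlonglongrightarrow> G z" using lim[of z] by simp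
      then have "(\<lambda>n. clip (g n z)) \<longlonglongrightarrow> clip (G z)"
        using cont_clip by (intro continuous_on_tendsto_compose[of UNIV clip]) auto
      then have "(\<lambda>n. h n z) \<longlonglongrightarrow> G z"
        by (simp add: h_def clip_id bd)
      then have "(\<lambda>n. disk_weight z * (norm (G z - h n z))\<^sup>2) \<longlonglongrightarrow> disk_weight z * (norm (G z - G z))\<^sup>2"
        by (intro tendsto_intros)
      then show ?case by simp
    qed
  qed measurable
  then have "\<forall>\<^sub>F n in sequentially. (LINT z|?D. disk_weight z * (norm (G z - h n z))\<^sup>2) < \<epsilon>"
    using \<open>\<epsilon> > 0\<close> by (simp add: order_tendstoD(2))
  then obtain n where "(LINT z|?D. disk_weight z * (norm (G z - h n z))\<^sup>2) < \<epsilon>"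
    by (auto simp: eventually_sequentially)
  moreover have "integrable ?D (\<lambda>z. disk_weight z * (norm (G z - h n z))\<^sup>2)"
    using bound by (intro integrable_const_bound[where B = "(B + (B + 1))\<^sup>2"] AE_I2) measurable
  ultimately show thesis
    using that[of "h n"] cont_h by simp
qed

lemma zpoly_dense_weighted_L2:
  fixes F :: "complex \<Rightarrow> complex"
  assumes F: "F \<in> borel_measurable (lebesgue_on (ball 0 1))"
    and int: "integrable (lebesgue_on (ball 0 1)) (\<lambda>z. disk_weight z * (norm (F z))\<^sup>2)"
    and "\<epsilon> > 0"
  obtains P where "P \<in> zpoly"
    "(LINT z|lebesgue_on (ball 0 1). disk_weight z * (norm (F z - P z))\<^sup>2) < \<epsilon>"
proof -
  let ?D = "lebesgue_on (ball (0::complex) 1)"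
  let ?d = "\<lambda>f g z. disk_weight z * (norm (f z - g z))\<^sup>2"
  define \<mu> where "\<mu> = measure ?D (space ?D)"
  \<comment> \<open>Three errors below \<epsilon> / 9 each, times the 3 from squaring a sum of three
    terms.\<close>
  have e9: "\<epsilon> / 9 > 0" using \<open>\<epsilon> > 0\<close> by simp
  obtain G n where G: "G \<in> borel_measurable ?D" "\<forall>z. norm (G z) \<le> real n"
    and FG: "integrable ?D (?d F G)" "integral\<^sup>L ?D (?d F G) < \<epsilon> / 9"
    using truncation_weighted_L2[OF F int e9] .
  obtain h where h: "continuous_on UNIV h" 
    and Gh: "integrable ?D (?d G h)" "integral\<^sup>L ?D (?d G h) < \<epsilon> / 9"
    using continuous_approx_weighted_L2[OF G e9] .
  \<comment> \<open>A uniform error \<delta> costs at most \<mu> times its square, as the weight is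
    at most 1. Using \<mu> + 1 makes the final bound strict and avoids division by 0.\<close>
  define \<delta> where "\<delta> = sqrt (\<epsilon> / (9 * (\<mu> + 1)))"
  have \<mu>: "\<mu> \<ge> 0" by (simp add: \<mu>_def)
  have \<delta>: "\<delta> > 0" "\<delta>\<^sup>2 = \<epsilon> / (9 * (\<mu> + 1))"
    using \<mu> \<open>\<epsilon> > 0\<close> by (auto simp: \<delta>_def)
  have "continuous_on (cball 0 1) h"
    using h continuous_on_subset by blast
  from Stone_Weierstrass_polynomial_function[OF compact_cball this \<delta>(1)]
  obtain P where "polynomial_function P" and P: "\<forall>z\<in>cball 0 1. norm (h z - P z) < \<delta>"
    by blast
  then have Pz: "P \<in> zpoly" by (intro zpoly_polynomial_function)
  have hP: "integrable ?D (?d h P)"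
    by (intro integrable_disk_continuous continuous_intros zpoly_continuous_on Pz 
        continuous_on_subset[OF h]) auto
  have "integral\<^sup>L ?D (?d h P) \<le> (LINT z|?D. \<delta>\<^sup>2)"
  proof (rule integral_mono[OF hP])
    show "integrable ?D (\<lambda>z. \<delta>\<^sup>2)"
      by (intro integrable_disk_continuous continuous_intros)
    fix z assume z: "z \<in> space ?D"
    then have "(norm (h z - P z))\<^sup>2 \<le> \<delta>\<^sup>2"
      using P by (intro power_mono) (auto simp: less_imp_le)
    moreover have "0 < disk_weight z" "disk_weight z \<le> 1"
      using z disk_weight_pos[of z] disk_weight_le_1 by auto
    ultimately have "?d h P z \<le> 1 * \<delta>\<^sup>2"
      by (intro mult_mono) auto
    then show "?d h P z \<le> \<delta>\<^sup>2" by simp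
  qed
  also have "\<dots> = \<mu> * \<delta>\<^sup>2" by (simp add: \<mu>_def)
  also have "\<dots> < \<epsilon> / 9"
    unfolding \<delta> using \<mu> \<open>\<epsilon> > 0\<close> by (simp add: field_simps)
  finally have hP': "integral\<^sup>L ?D (?d h P) < \<epsilon> / 9" .
  have "integral\<^sup>L ?D (?d F P) \<le> (LINT z|?D. 3 * (?d F G z + ?d G h z + ?d h P z))"
  \<comment> \<open>Integrability is asked of the dominating side only: a non-integrable left side
    would have integral 0, below a nonnegative bound.\<close>
  proof (rule integral_mono')
    show "integrable ?D (\<lambda>z. 3 * (?d F G z + ?d G h z + ?d h P z))"
      using FG Gh hP by (intro integrable_mult_right Bochner_Integration.integrable_add)
    fix z assume z: "z \<in> space ?D"
    then have w: "0 < disk_weight z"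
      using disk_weight_pos[of z] by auto
    have "norm (F z - P z) \<le> norm (F z - G z) + norm (G z - h z) + norm (h z - P z)"
      using norm_triangle_ineq[of "F z - G z" "G z - P z"]
        norm_triangle_ineq[of "G z - h z" "h z - P z"] by simp
    then have "(norm (F z - P z))\<^sup>2 \<le> (norm (F z - G z) + norm (G z - h z) + norm (h z - P z))\<^sup>2"
      by (intro power_mono) auto
    also have "\<dots> \<le> 3 * ((norm (F z - G z))\<^sup>2 + (norm (G z - h z))\<^sup>2 + (norm (h z - P z))\<^sup>2)"
    proof -
      \<comment> \<open>The difference of the two sides is the sum of the squares of a - b, b - c
        and a - c.\<close>
      have "(a + b + c)\<^sup>2 \<le> 3 * (a\<^sup>2 + b\<^sup>2 + c\<^sup>2)" for a b c :: real
        using sum_squares_ge_zero[of "a - b" "b - c"] zero_le_power2[of "a - c"]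
        by (simp add: power2_eq_square algebra_simps)
      then show ?thesis .
    qed
    finally have "?d F P z \<le> disk_weight z * 
        (3 * ((norm (F z - G z))\<^sup>2 + (norm (G z - h z))\<^sup>2 + (norm (h z - P z))\<^sup>2))"
      using w by (intro mult_left_mono) auto
    then show "?d F P z \<le> 3 * (?d F G z + ?d G h z + ?d h P z)"
      by (simp only: distrib_left mult.left_commute[of "disk_weight z" 3])
    show "0 \<le> 3 * (?d F G z + ?d G h z + ?d h P z)"
      using w by simp
  qed
  also have "\<dots> = 3 * (integral\<^sup>L ?D (?d F G) + integral\<^sup>L ?D (?d G h) + integral\<^sup>L ?D (?d h P))"
    using FG Gh hP by (simp only: integral_mult_right_zero Bochner_Integration.integral_add
        Bochner_Integration.integrable_add)
  also have "\<dots> < \<epsilon>"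
    using FG Gh hP' by simp
  finally show thesis using that Pz by blast
qed

text \<open>Division by 1 - |z|^2 preserves norms from the given space to the one with weight 1 -
  |z|^2. Polynomials approximate there, and multiplying back lands in the span.\<close>

lemma scattering_poly_span_dense:
  assumes f: "f \<in> L2 disk_measure" and "\<epsilon> > 0"
  obtains g where "g \<in> complex_span {(p, q). min p q \<ge> 1} (\<lambda>(p, q). scattering_poly p q)"
    "l2_norm disk_measure (\<lambda>z. f z - g z) < \<epsilon>"
proof -
  let ?D = "lebesgue_on (ball (0::complex) 1)"
  have fm: "f \<in> borel_measurable ?D"
    using f by (simp add: L2_def borel_measurable_disk_measure_iff)
  define F where "F z = f z / of_real (disk_weight z)" for z
  have Fm: "F \<in> borel_measurable ?D"
    unfolding F_def
    by (intro borel_measurable_divide[OF fm] borel_measurable_disk_continuous continuous_intros)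
  have sq: "(1 / disk_weight z) * (norm (f z - of_real (disk_weight z) * u))\<^sup>2 =
      disk_weight z * (norm (F z - u))\<^sup>2" if "z \<in> space ?D" for z u
  proof -
    have w: "disk_weight z > 0" using that disk_weight_pos[of z] by auto
    then have "f z - of_real (disk_weight z) * u = of_real (disk_weight z) * (F z - u)"
      by (simp add: F_def field_simps del: of_real_diff of_real_power)
    then have "norm (f z - of_real (disk_weight z) * u) = disk_weight z * norm (F z - u)"
      using w by (simp add: norm_mult del: of_real_diff of_real_power)
    then show ?thesis
      using w by (simp add: power2_eq_square del: of_real_diff of_real_power)
  qed
  have "integrable ?D (\<lambda>z. (1 / disk_weight z) *\<^sub>R (norm (f z))\<^sup>2)"
    using f fm by (simp add: L2_def integrable_disk_measure_iff)
  also have "?this \<longleftrightarrow> integrable ?D (\<lambda>z. disk_weight z * (norm (F z))\<^sup>2)"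
    using sq[of _ 0] by (intro Bochner_Integration.integrable_cong) auto
  finally have Fint: "integrable ?D (\<lambda>z. disk_weight z * (norm (F z))\<^sup>2)" .
  have "\<epsilon>\<^sup>2 > 0" using \<open>\<epsilon> > 0\<close> by simp
  then obtain P where P: "P \<in> zpoly"
    and lt: "(LINT z|?D. disk_weight z * (norm (F z - P z))\<^sup>2) < \<epsilon>\<^sup>2"
    using zpoly_dense_weighted_L2[OF Fm Fint] by blast
  define g where "g z = of_real (disk_weight z) * P z" for z
  have gm: "g \<in> borel_measurable ?D"
    unfolding g_def
    by (intro borel_measurable_disk_continuous continuous_intros zpoly_continuous_on P)
  have "l2_inner disk_measure (\<lambda>z. f z - g z) (\<lambda>z. f z - g z) =
      (LINT z|disk_measure. complex_of_real ((norm (f z - g z))\<^sup>2))"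
    unfolding l2_inner_def by (simp only: complex_norm_square)
  also have "\<dots> = of_real (LINT z|disk_measure. (norm (f z - g z))\<^sup>2)"
    by (rule integral_complex_of_real)
  also have "(LINT z|disk_measure. (norm (f z - g z))\<^sup>2) =
      (LINT z|?D. (1 / disk_weight z) *\<^sub>R (norm (f z - g z))\<^sup>2)"
    using fm gm by (intro integral_disk_measure) measurable
  also have "\<dots> = (LINT z|?D. disk_weight z * (norm (F z - P z))\<^sup>2)"
    using sq by (intro Bochner_Integration.integral_cong) (auto simp: g_def)
  finally have "l2_norm disk_measure (\<lambda>z. f z - g z) < sqrt (\<epsilon>\<^sup>2)"
    unfolding l2_norm_def using lt by (simp only: Re_complex_of_real real_sqrt_less_iff)
  then show thesis
    using that[of g] disk_weight_zpoly_in_span[OF P] \<open>\<epsilon> > 0\<close> by (simp add: g_def[abs_def])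
qed

theorem theorem1:
  "orthogonal_basis_L2 disk_measure {(p, q). min p q \<ge> 1}
     (\<lambda>(p, q). scattering_poly p q)"
  unfolding orthogonal_basis_L2_def
proof (intro conjI ballI allI impI)
  fix f :: "complex \<Rightarrow> complex" and \<epsilon> :: real
  assume "f \<in> L2 disk_measure" "\<epsilon> > 0"
  then show "\<exists>g\<in>complex_span {(p, q). min p q \<ge> 1} (\<lambda>(p, q). scattering_poly p q).
      l2_norm disk_measure (\<lambda>x. f x - g x) < \<epsilon>"
    by (rule scattering_poly_span_dense) blast
qed (auto simp: scattering_poly_in_L2 scattering_poly_not_AE_0 intro!: scattering_poly_orthogonal)

end
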